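(* Let $S\in\mathbb{N}$ and, for $s=1,\dots,S$, let $Z_s$ be non-negative random variables (on a common probability space) that satisfy, for certain positive constants $H_1,\dots,H_S$ and for all $a>0$, $$\mathbb{P}\big(Z_s\ge\sqrt{H_s+a}\big)\le\exp[-a],\qquad s=1,\dots,S .$$ Then $$\mathbb{E}\max_{1\le s\le S}\Big[Z_s-\sqrt{H_s+s\log2}\Big]_+^2\le1 .$$
   Context: $[x]_+:=\max(x,0)$ denotes the positive part of $x\in\mathbb{R}$, and $[x]_+^2=([x]_+)^2$. *)

theory Defs
  imports "HOL-Probability.Probability"
begin

definition pos_part :: "real \<Rightarrow> real"  ("[_]\<^sub>+")
  where "[x]\<^sub>+ = max x 0"

end

theory Submission
  imports Defs
begin

text \<open>Since \<open>sqrt (A + t) \<le> sqrt A + sqrt t\<close>, a shift by \<open>s ln 2\<close> under the root costs a factor \<open>2\<^sup>-\<^sup>s\<close> in the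
  tail. The maximum is at most the sum, whose \<open>s\<close>-th term has tail at most \<open>exp (- s ln 2 - t)\<close>
  and therefore expectation at most \<open>2\<^sup>-\<^sup>s\<close>.\<close>

lemma nn_integral_layer_cake:
  fixes f :: "'a \<Rightarrow> real"
  assumes "sigma_finite_measure M" and [measurable]: "f \<in> borel_measurable M"
    and nonneg: "\<And>x. x \<in> space M \<Longrightarrow> 0 \<le> f x"
  shows "(\<integral>\<^sup>+x. ennreal (f x) \<partial>M) =
         (\<integral>\<^sup>+t. emeasure M {x \<in> space M. t \<le> f x} * indicator {0..} t \<partial>lborel)"
proof -
  interpret sigma_finite_measure M by fact
  interpret pair_sigma_finite M lborel ..
  have "(\<integral>\<^sup>+x. ennreal (f x) \<partial>M) = (\<integral>\<^sup>+x. (\<integral>\<^sup>+t. indicator {0..f x} t \<partial>lborel) \<partial>M)"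
    using nonneg by (intro nn_integral_cong) simp
  also have "\<dots> = (\<integral>\<^sup>+x. (\<integral>\<^sup>+t. indicator {p. 0 \<le> snd p \<and> snd p \<le> f (fst p)} (x, t) \<partial>lborel) \<partial>M)"
    by (intro nn_integral_cong) (auto simp: indicator_def)
  also have "\<dots> = (\<integral>\<^sup>+t. (\<integral>\<^sup>+x. indicator {p. 0 \<le> snd p \<and> snd p \<le> f (fst p)} (x, t) \<partial>M) \<partial>lborel)"
    by (rule Fubini'[symmetric]) simp
  also have "\<dots> = (\<integral>\<^sup>+t. (\<integral>\<^sup>+x. indicator {0..} t * indicator {x \<in> space M. t \<le> f x} x \<partial>M) \<partial>lborel)"
    by (intro nn_integral_cong) (auto simp: indicator_def)
  also have "\<dots> = (\<integral>\<^sup>+t. emeasure M {x \<in> space M. t \<le> f x} * indicator {0..} t \<partial>lborel)"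
    by (intro nn_integral_cong) (simp add: nn_integral_cmult mult.commute)
  finally show ?thesis .
qed

lemma nn_integral_le_of_exp_tail:
  fixes f :: "'a \<Rightarrow> real"
  assumes "sigma_finite_measure M" "f \<in> borel_measurable M"
    and "\<And>x. x \<in> space M \<Longrightarrow> 0 \<le> f x" and "0 \<le> c"
    and tail: "\<And>t. t > 0 \<Longrightarrow> emeasure M {x \<in> space M. t \<le> f x} \<le> ennreal (c * exp (- t))"
  shows "(\<integral>\<^sup>+x. ennreal (f x) \<partial>M) \<le> ennreal c"
proof -
  have "(\<integral>\<^sup>+x. ennreal (f x) \<partial>M) =
      (\<integral>\<^sup>+t. emeasure M {x \<in> space M. t \<le> f x} * indicator {0..} t \<partial>lborel)"
    using assms(1-3) by (rule nn_integral_layer_cake)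
  also have "\<dots> \<le> (\<integral>\<^sup>+t. ennreal c * (ennreal (t ^ 0 * exp (- t)) * indicator {0..} t) \<partial>lborel)"
    using AE_lborel_singleton[of "0::real"] \<open>0 \<le> c\<close>
    by (intro nn_integral_mono_AE) (auto simp: indicator_def ennreal_mult'[symmetric] intro!: tail elim!: eventually_mono)
  also have "\<dots> = ennreal c"
    using nn_intergal_power_times_exp_Ici[of 0] by (simp add: nn_integral_cmult)
  finally show ?thesis .
qed

lemma sqrt_add_le_of_le_pos_part_square:
  assumes "0 \<le> A" "0 < t" "t \<le> ([z - sqrt A]\<^sub>+)\<^sup>2"
  shows "sqrt (A + t) \<le> z"
proof -
  have "sqrt t \<le> [z - sqrt A]\<^sub>+"
    using assms(3) by (simp add: real_le_lsqrt pos_part_def)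
  with \<open>0 < t\<close> have "sqrt t \<le> z - sqrt A"
    by (auto simp: pos_part_def max_def split: if_splits)
  moreover have "sqrt (A + t) \<le> sqrt A + sqrt t"
    using assms by (simp add: sqrt_add_le_add_sqrt)
  ultimately show ?thesis by simp
qed

theorem lemma3p4p1:
  fixes M :: "'a measure" and S :: nat
    and Z :: "nat \<Rightarrow> 'a \<Rightarrow> real" and H :: "nat \<Rightarrow> real"
  assumes "prob_space M"
    and "S \<ge> 1"
    and "\<And>s. s \<in> {1..S} \<Longrightarrow> Z s \<in> borel_measurable M"
    and "\<And>s \<omega>. s \<in> {1..S} \<Longrightarrow> \<omega> \<in> space M \<Longrightarrow> Z s \<omega> \<ge> 0"
    and "\<And>s. s \<in> {1..S} \<Longrightarrow> H s > 0"
    and "\<And>s (a::real). s \<in> {1..S} \<Longrightarrow> a > 0 \<Longrightarrow>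
           \<P>(\<omega> in M. Z s \<omega> \<ge> sqrt (H s + a)) \<le> exp (- a)"
  shows "integrable M (\<lambda>\<omega>. MAX s\<in>{1..S}. ([Z s \<omega> - sqrt (H s + real s * ln 2)]\<^sub>+)\<^sup>2) \<and>
         prob_space.expectation M
           (\<lambda>\<omega>. MAX s\<in>{1..S}. ([Z s \<omega> - sqrt (H s + real s * ln 2)]\<^sub>+)\<^sup>2) \<le> 1"
proof -
  interpret prob_space M by fact
  define f where "f s \<omega> = ([Z s \<omega> - sqrt (H s + real s * ln 2)]\<^sub>+)\<^sup>2" for s \<omega>
  define g where "g \<omega> = (MAX s\<in>{1..S}. f s \<omega>)" for \<omega>
  have f_nonneg: "0 \<le> f s \<omega>" for s \<omega>
    by (simp add: f_def)
  have f_meas: "f s \<in> borel_measurable M" if "s \<in> {1..S}" for s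
    unfolding f_def pos_part_def using assms(3)[OF that] by measurable
  have f_int: "(\<integral>\<^sup>+\<omega>. ennreal (f s \<omega>) \<partial>M) \<le> ennreal ((1/2) ^ s)" if s: "s \<in> {1..S}" for s
  proof (rule nn_integral_le_of_exp_tail)
    fix t :: real assume t: "t > 0"
    have "emeasure M {\<omega> \<in> space M. t \<le> f s \<omega>}
        \<le> emeasure M {\<omega> \<in> space M. Z s \<omega> \<ge> sqrt (H s + (real s * ln 2 + t))}"
      using sqrt_add_le_of_le_pos_part_square[OF _ t, of "H s + real s * ln 2"]
        assms(3,5)[OF s] less_imp_le[of 0 "H s"]
      by (intro emeasure_mono) (auto simp: f_def add.assoc)
    also have "\<dots> \<le> ennreal (exp (- (real s * ln 2 + t)))"
      unfolding emeasure_eq_measure using assms(6)[OF s, of "real s * ln 2 + t"] t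
      by (intro ennreal_leI) (simp add: add_nonneg_pos)
    also have "exp (- (real s * ln 2 + t)) = (1/2) ^ s * exp (- t)"
      by (simp add: exp_diff exp_minus exp_of_nat_mult field_simps)
    finally show "emeasure M {\<omega> \<in> space M. t \<le> f s \<omega>} \<le> ennreal ((1/2) ^ s * exp (- t))" .
  qed (use f_meas[OF s] f_nonneg sigma_finite_measure_axioms in auto)
  have g_le: "g \<omega> \<le> (\<Sum>s\<in>{1..S}. f s \<omega>)" for \<omega>
    unfolding g_def using \<open>S \<ge> 1\<close> f_nonneg
    by (subst Max_le_iff) (auto intro!: member_le_sum)
  have g_nonneg: "0 \<le> g \<omega>" for \<omega>
    unfolding g_def using \<open>S \<ge> 1\<close> f_nonneg by (subst Max_ge_iff) auto
  have g_meas: "g \<in> borel_measurable M"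
    unfolding g_def using f_meas by (intro borel_measurable_Max) auto
  have "(\<integral>\<^sup>+\<omega>. ennreal (g \<omega>) \<partial>M) \<le> (\<integral>\<^sup>+\<omega>. (\<Sum>s\<in>{1..S}. ennreal (f s \<omega>)) \<partial>M)"
    using g_le f_nonneg by (intro nn_integral_mono) (simp add: ennreal_leI)
  also have "\<dots> = (\<Sum>s\<in>{1..S}. \<integral>\<^sup>+\<omega>. ennreal (f s \<omega>) \<partial>M)"
    using f_meas by (intro nn_integral_sum) auto
  also have "\<dots> \<le> (\<Sum>s\<in>{1..S}. ennreal ((1/2) ^ s))"
    using f_int by (intro sum_mono)
  also have "\<dots> = ennreal (\<Sum>s\<in>{1..S}. (1/2) ^ s)"
    by simp
  also have "(\<Sum>s\<in>{1..S}. (1/2) ^ s) = 1 - (1/2::real) ^ S"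
    using \<open>S \<ge> 1\<close> by (subst sum_gp) auto
  also have "ennreal (1 - (1/2) ^ S) \<le> 1"
    by (simp add: ennreal_le_1)
  finally have *: "(\<integral>\<^sup>+\<omega>. ennreal (g \<omega>) \<partial>M) \<le> 1" .
  have "integrable M g"
    using g_meas g_nonneg * by (intro integrableI_nonneg) (auto intro: le_less_trans)
  moreover have "expectation g \<le> 1"
    using * g_meas g_nonneg
    by (simp add: integral_eq_nn_integral enn2real_leI)
  ultimately show ?thesis
    unfolding g_def f_def by simp
qed

end
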